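(* Fix an integer $k\ge 2$. The numbers $S^{III}(n;m',u')$ with $m',u'\in\{0,1\}$ enumerate the following generalized lattice paths. (1) $S^{III}(n;0,0)$ is the number of $k$-Dyck paths of size $n$. (2) $S^{III}(n;0,1)$ is the number of $k$-Dyck paths of size $n$ with two types of up steps, namely $S^{III}(n;0,1)=2^{n}|\mathtt{Dyck}(n;k)|$. (3) $S^{III}(n;1,0)$ is the number of paths from $(0,0)$ to $((k+1)n,0)$ which stay in the first quadrant (axes included) and in which each step is $(1,k)$, $(2,k-1)$ or $(1,-1)$. (4) $S^{III}(n;1,1)$ is the weighted sum over $k$-Dyck paths $\mu$ of size $n$, where the path $\mu$ has weight $4^{\mathrm{Peak}(\mu)}3^{n-\mathrm{Peak}(\mu)}$.
   Context: Let $\kappa(m,r,s,u)$ (written $\kappa(r)$) be the formal power series in $r$ satisfying $\kappa(r)=1-rs(m-1)\prod_{j=0}^{k-1}\kappa(rs^{j})-rs(m(u-1)+1)\prod_{j=0}^{k}\kappa(rs^{j})$. With $m'=m-1$ and $u'=u-1$, define $S^{III}(n;m',u')=(-1)^n[r^n]\,\kappa$ evaluated at $s=1$, $m=m'+1$, $u=u'+1$. A $k$-Dyck path of size $n$ is a lattice path from $(0,0)$ to $(kn,n)$ consisting of up steps $U=(0,1)$ and down steps $D=(1,0)$ which never goes below the line $y=x/k$; $\mathtt{Dyck}(n;k)$ is the set of them. $\mathrm{Peak}(\mu)$ is the number of occurrences of the pattern $UD$ (consecutive steps) in $\mu$. *)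

theory Defs
  imports
    Complex_Main
    "HOL-Library.Product_Plus"
    "HOL-Computational_Algebra.Computational_Algebra"
begin

text \<open>
  The coefficients of the power series in \<open>r\<close> are polynomials over the integers in the
  indeterminates \<open>m\<close> (innermost), \<open>s\<close> and \<open>u\<close> (outermost).
\<close>

type_synonym coeff_ring = "int poly poly poly"

definition var_m :: coeff_ring where "var_m = [:[:[:0, 1:]:]:]"
definition var_s :: coeff_ring where "var_s = [:[:0, 1:]:]"
definition var_u :: coeff_ring where "var_u = [:0, 1:]"

definition eval_msu :: "int \<Rightarrow> int \<Rightarrow> int \<Rightarrow> coeff_ring \<Rightarrow> int" where
  "eval_msu m s u p = poly (poly (poly p [:[:u:]:]) [:s:]) m"

text \<open>The substitution \<open>r \<mapsto> r s\<^sup>j\<close>; \<open>fps_X\<close> plays the role of \<open>r\<close>.\<close>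

definition dilate :: "nat \<Rightarrow> coeff_ring fps \<Rightarrow> coeff_ring fps" where
  "dilate j f = f oo (fps_X * fps_const (var_s ^ j))"

definition kappa_equation :: "nat \<Rightarrow> coeff_ring fps \<Rightarrow> bool" where
  "kappa_equation k f \<longleftrightarrow>
     f = 1
       - fps_X * fps_const (var_s * (var_m - 1)) * (\<Prod>j = 0..<k. dilate j f)
       - fps_X * fps_const (var_s * (var_m * (var_u - 1) + 1)) * (\<Prod>j = 0..k. dilate j f)"

text \<open>
  The coefficient of \<open>r\<^sup>n\<close> on the right-hand side only involves coefficients of \<open>f\<close> of index less
  than \<open>n\<close>, so there is exactly one solution.
\<close>

definition kappa :: "nat \<Rightarrow> coeff_ring fps" where
  "kappa k = (THE f. kappa_equation k f)"

definition S_III :: "nat \<Rightarrow> nat \<Rightarrow> int \<Rightarrow> int \<Rightarrow> int" where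
  "S_III k n m' u' = (-1) ^ n * eval_msu (m' + 1) 1 (u' + 1) (fps_nth (kappa k) n)"

text \<open>
  A lattice path starting at the origin is the list of its step vectors. For all paths below, the
  region a path has to stay in is convex, so it suffices to constrain its vertices.
\<close>

type_synonym lattice_path = "(int \<times> int) list"

definition vertices :: "lattice_path \<Rightarrow> (int \<times> int) set" where
  "vertices w = {sum_list (take i w) | i. i \<le> length w}"

definition up :: "int \<times> int" where "up = (0, 1)"
definition down :: "int \<times> int" where "down = (1, 0)"

definition Dyck :: "nat \<Rightarrow> nat \<Rightarrow> lattice_path set" where
  "Dyck n k = {w. set w \<subseteq> {up, down} \<and> sum_list w = (int (k * n), int n) \<and>
                  (\<forall>(x, y) \<in> vertices w. real_of_int y \<ge> real_of_int x / real k)}"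

definition Peak :: "lattice_path \<Rightarrow> nat" where
  "Peak w = card {i. Suc i < length w \<and> w ! i = up \<and> w ! Suc i = down}"

text \<open>
  Two types of up steps: every step carries a Boolean, which is the type of an up step and is
  constantly \<open>False\<close> on down steps.
\<close>

definition Dyck_two_up :: "nat \<Rightarrow> nat \<Rightarrow> ((int \<times> int) \<times> bool) list set" where
  "Dyck_two_up n k = {w. map fst w \<in> Dyck n k \<and> (\<forall>(a, c) \<in> set w. a = down \<longrightarrow> \<not> c)}"

definition quadrant_paths :: "nat \<Rightarrow> nat \<Rightarrow> lattice_path set" where
  "quadrant_paths n k =
     {w. set w \<subseteq> {(1, int k), (2, int k - 1), (1, -1)} \<and> sum_list w = (int ((k + 1) * n), 0) \<and>
         (\<forall>(x, y) \<in> vertices w. x \<ge> 0 \<and> y \<ge> 0)}"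

end

theory Submission imports Defs begin

text \<open>
  At \<open>s = 1\<close> and with \<open>r\<close> replaced by \<open>- r\<close>, the equation for \<open>\<kappa>\<close> becomes
  \<open>F = 1 + r (a F\<^sup>k + c F\<^sup>k\<^sup>+\<^sup>1)\<close> with \<open>a = m'\<close> and \<open>c = (m' + 1) u' + 1\<close>. Multiplying it by
  \<open>F\<^sup>j\<close> shows that the series \<open>P\<^sub>j = F\<^sup>j\<^sup>+\<^sup>1\<close> satisfy
  \<open>P\<^sub>j = P\<^sub>j\<^sub>-\<^sub>1 + r (a P\<^sub>j\<^sub>+\<^sub>k\<^sub>-\<^sub>1 + c P\<^sub>j\<^sub>+\<^sub>k)\<close>, where \<open>P\<^sub>-\<^sub>1\<close> is read as 1. Removing the first step of
  a path gives the same recursion for the weighted number of nonnegative paths from height \<open>j\<close> to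
  height 0, so the two families agree and no arch decomposition of paths is needed.
\<close>

section \<open>Causal equations for power series\<close>

text \<open>Strict contractions for the X-adic metric. The next lemmas are the contraction
  principle, and they ensure that the \<open>THE\<close> in \<open>kappa\<close> denotes a
  solution.\<close>

definition causal :: "('a::zero fps \<Rightarrow> 'a fps) \<Rightarrow> bool" where
  "causal \<Phi> \<longleftrightarrow> (\<forall>n f g. (\<forall>i<n. f $ i = g $ i) \<longrightarrow> \<Phi> f $ n = \<Phi> g $ n)"

lemma causalD: "causal \<Phi> \<Longrightarrow> (\<And>i. i < n \<Longrightarrow> f $ i = g $ i) \<Longrightarrow> \<Phi> f $ n = \<Phi> g $ n"
  unfolding causal_def by blast

lemma causal_fixpoint_unique:
  assumes "causal \<Phi>" "f = \<Phi> f" "g = \<Phi> g"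
  shows "f = g"
proof -
  have "f $ n = g $ n" for n
  proof (induction n rule: less_induct)
    case (less n)
    have "\<Phi> f $ n = \<Phi> g $ n" by (rule causalD[OF assms(1)]) (rule less)
    with assms(2,3) show ?case by simp
  qed
  thus ?thesis by (simp add: fps_eq_iff)
qed

lemma causal_fixpoint_exists:
  assumes "causal \<Phi>"
  shows "\<exists>f. f = \<Phi> f"
proof -
  define it where "it N = (\<Phi> ^^ N) 0" for N
  have it_Suc: "it (Suc N) = \<Phi> (it N)" for N by (simp add: it_def)
  \<comment> \<open>Each application of \<Phi> settles one further coefficient, so coefficient i is
    constant from iterate i + 1 on and the limit can be read off the diagonal.\<close>
  have step: "it N $ i = it (Suc N) $ i" if "i < N" for N i
    using that
  proof (induction N arbitrary: i)
    case (Suc N)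
    have "\<Phi> (it N) $ i = \<Phi> (it (Suc N)) $ i"
      by (rule causalD[OF assms]) (use Suc in auto)
    thus ?case by (simp only: it_Suc)
  qed simp
  have stable: "it n $ i = it (Suc i) $ i" if "i < n" for n i
    using Suc_leI[OF that]
  proof (induction n rule: dec_induct)
    case (step n)
    thus ?case using \<open>\<And>N i. i < N \<Longrightarrow> it N $ i = it (Suc N) $ i\<close>[of i n] by simp
  qed simp
  define f where "f = Abs_fps (\<lambda>n. it (Suc n) $ n)"
  have "f $ n = \<Phi> f $ n" for n
  proof -
    have "it n $ i = f $ i" if "i < n" for i
      using stable[OF that] by (simp add: f_def)
    hence "\<Phi> (it n) $ n = \<Phi> f $ n" by (rule causalD[OF assms])
    thus ?thesis by (simp add: f_def it_Suc)
  qed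
  thus ?thesis by (metis fps_ext)
qed

lemma dilate_nth: "dilate j f $ n = f $ n * var_s ^ (j * n)"
proof -
  have "dilate j f = Abs_fps (\<lambda>n. (var_s ^ j) ^ n * f $ n)"
    unfolding dilate_def by (subst mult.commute) (rule fps_compose_linear)
  thus ?thesis by (simp add: power_mult mult.commute)
qed

lemma prod_dilate_nth_cong:
  assumes "finite A" "\<And>i. i < n \<Longrightarrow> f $ i = g $ i" "i < n"
  shows "(\<Prod>j\<in>A. dilate j f) $ i = (\<Prod>j\<in>A. dilate j g) $ i"
  using assms(1,3)
proof (induction A arbitrary: i)
  case (insert a A)
  have "(dilate a f * (\<Prod>j\<in>A. dilate j f)) $ i = (dilate a g * (\<Prod>j\<in>A. dilate j g)) $ i"
    unfolding fps_mult_nth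
    by (rule sum.cong) (use insert assms(2) in \<open>auto simp: dilate_nth\<close>)
  with insert show ?case by simp
qed simp

lemma kappa_equation_kappa: "kappa_equation k (kappa k)"
proof -
  define \<Phi> where "\<Phi> f = 1
       - fps_X * fps_const (var_s * (var_m - 1)) * (\<Prod>j = 0..<k. dilate j f)
       - fps_X * fps_const (var_s * (var_m * (var_u - 1) + 1)) * (\<Prod>j = 0..k. dilate j f)" for f
  have "causal \<Phi>"
    unfolding causal_def
  proof (intro allI impI)
    fix n and f g :: "coeff_ring fps"
    assume eq: "\<forall>i<n. f $ i = g $ i"
    show "\<Phi> f $ n = \<Phi> g $ n"
    \<comment> \<open>The factor \<open>fps_X\<close> shifts by one: coefficient n of the right-hand
      side uses the products only at n - 1, hence f only below n.\<close>
    proof (cases n)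
      case (Suc n')
      have "(\<Prod>j\<in>A. dilate j f) $ n' = (\<Prod>j\<in>A. dilate j g) $ n'" if "finite A" for A
        by (rule prod_dilate_nth_cong[of A n]) (use that eq Suc in auto)
      thus ?thesis by (simp add: \<Phi>_def Suc mult.assoc)
    qed (simp add: \<Phi>_def mult.assoc)
  qed
  moreover have "kappa_equation k = (\<lambda>f. f = \<Phi> f)"
    by (simp add: fun_eq_iff kappa_equation_def \<Phi>_def)
  ultimately have "\<exists>!f. kappa_equation k f"
    by (metis causal_fixpoint_exists causal_fixpoint_unique)
  thus ?thesis unfolding kappa_def by (rule theI')
qed

section \<open>Specialisation\<close>

lemma eval_msu_simps [simp]:
  "eval_msu m s u 0 = 0" "eval_msu m s u 1 = 1"
  "eval_msu m s u (p + q) = eval_msu m s u p + eval_msu m s u q"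
  "eval_msu m s u (p - q) = eval_msu m s u p - eval_msu m s u q"
  "eval_msu m s u (p * q) = eval_msu m s u p * eval_msu m s u q"
  "eval_msu m s u (p ^ n) = eval_msu m s u p ^ n"
  "eval_msu m s u var_m = m" "eval_msu m s u var_s = s" "eval_msu m s u var_u = u"
  by (simp_all add: eval_msu_def var_m_def var_s_def var_u_def)

lemma eval_msu_sum: "eval_msu m s u (sum f A) = (\<Sum>x\<in>A. eval_msu m s u (f x))"
  by (induction A rule: infinite_finite_induct) auto

text \<open>The specialisation s = 1 combined with r -> -r. It is a ring homomorphism that makes
  every dilation disappear, so the functional equation of \<kappa> becomes algebraic.\<close>

definition signed_eval :: "int \<Rightarrow> int \<Rightarrow> coeff_ring fps \<Rightarrow> int fps" where
  "signed_eval m u f = Abs_fps (\<lambda>n. (-1) ^ n * eval_msu m 1 u (f $ n))"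

lemma signed_eval_mult: "signed_eval m u (f * g) = signed_eval m u f * signed_eval m u g"
proof (rule fps_ext)
  fix n
  have "(\<Sum>i=0..n. (-1) ^ n * (eval_msu m 1 u (f $ i) * eval_msu m 1 u (g $ (n - i)))) =
        (\<Sum>i=0..n. ((-1) ^ i * eval_msu m 1 u (f $ i)) * ((-1) ^ (n - i) * eval_msu m 1 u (g $ (n - i))))"
    (is "sum ?l _ = sum ?r _")
  proof (rule sum.cong)
    fix i assume "i \<in> {0..n}"
    hence "(-1 :: int) ^ n = (-1) ^ i * (-1) ^ (n - i)"
      by (simp flip: power_add)
    thus "?l i = ?r i" by (simp add: mult_ac)
  qed simp
  thus "signed_eval m u (f * g) $ n = (signed_eval m u f * signed_eval m u g) $ n"
    by (simp add: signed_eval_def fps_mult_nth eval_msu_sum sum_distrib_left)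
qed

lemma signed_eval_simps [simp]:
  "signed_eval m u 1 = 1"
  "signed_eval m u (f - g) = signed_eval m u f - signed_eval m u g"
  "signed_eval m u (fps_const c) = fps_const (eval_msu m 1 u c)"
  "signed_eval m u fps_X = - fps_X"
  "signed_eval m u (dilate j f) = signed_eval m u f"
  by (auto simp: fps_eq_iff signed_eval_def dilate_nth algebra_simps)

lemma signed_eval_prod: "signed_eval m u (\<Prod>j\<in>A. f j) = (\<Prod>j\<in>A. signed_eval m u (f j))"
  by (induction A rule: infinite_finite_induct) (auto simp: signed_eval_mult)

definition S_III_fps :: "nat \<Rightarrow> int \<Rightarrow> int \<Rightarrow> int fps" where
  "S_III_fps k m' u' = Abs_fps (\<lambda>n. S_III k n m' u')"

lemma S_III_fps_equation:
  fixes k :: nat and m' u' :: int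
  defines "F \<equiv> S_III_fps k m' u'"
  shows "F = 1 + fps_X * (fps_const m' * F ^ k + fps_const ((m' + 1) * u' + 1) * F ^ Suc k)"
proof -
  have F: "F = signed_eval (m' + 1) (u' + 1) (kappa k)"
    by (simp add: F_def S_III_fps_def signed_eval_def S_III_def)
  show ?thesis
    unfolding F
    \<comment> \<open>The sign from r -> -r cancels both minus signs. With m = m' + 1 and u = u' +
      1, the factors m - 1 and m(u - 1) + 1 become the stated ones.\<close>
    by (subst kappa_equation_kappa[unfolded kappa_equation_def])
       (simp add: signed_eval_mult signed_eval_prod, simp add: algebra_simps)
qed

lemma power_coeff_eqI:
  fixes P :: "nat \<Rightarrow> nat \<Rightarrow> 'a::comm_ring_1"
  assumes F: "F = 1 + fps_X * (fps_const a * F ^ k + fps_const c * F ^ Suc k)"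
    and "k \<ge> 1"
    and P: "\<And>j n. P j n = (if j = 0 then of_bool (n = 0) else P (j - 1) n)
      + (if n = 0 then 0 else a * P (j + k - 1) (n - 1) + c * P (j + k) (n - 1))"
  shows "P j n = (F ^ Suc j) $ n"
proof (induction n arbitrary: j rule: less_induct)
  case (less n)
  have step: "(F ^ Suc i) $ n = (F ^ i) $ n + (if n = 0 then 0 else
      a * P (i + k - 1) (n - 1) + c * P (i + k) (n - 1))" for i
  proof -
    have "F ^ Suc i = F ^ i * F" by (simp add: mult.commute)
    also have "\<dots> = F ^ i * (1 + fps_X * (fps_const a * F ^ k + fps_const c * F ^ Suc k))"
      using F by simp
    also have "\<dots> = F ^ i + fps_X * (fps_const a * F ^ (i + k) + fps_const c * F ^ Suc (i + k))"
      by (simp add: algebra_simps power_add)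
    finally have eq: "F ^ Suc i = \<dots>" .
    \<comment> \<open>This keeps the subtraction from truncating: the hypothesis at index i + k - 1
      speaks of F^(i + k).\<close>
    from \<open>k \<ge> 1\<close> have "Suc (i + k - 1) = i + k" by simp
    thus ?thesis unfolding eq
      using less[of "n - 1" "i + k - 1"] less[of "n - 1" "i + k"]
      by (cases n) (simp_all del: power_Suc)
  qed
  show ?case
  \<comment> \<open>The term \<open>P (j - 1) n\<close> keeps n, hence a second induction, on j. It
    starts from F^0 = 1, whose coefficients are the \<open>of_bool\<close> term.\<close>
  proof (induction j)
    case 0
    show ?case by (subst P, subst step) simp
  next
    case (Suc j)
    show ?case by (subst P, subst step) (use Suc in simp)
  qed
qed

lemma S_III_eqI:
  fixes P :: "nat \<Rightarrow> nat \<Rightarrow> int"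
  assumes "k \<ge> 1"
    and "\<And>j n. P j n = (if j = 0 then of_bool (n = 0) else P (j - 1) n)
      + (if n = 0 then 0 else m' * P (j + k - 1) (n - 1) + ((m' + 1) * u' + 1) * P (j + k) (n - 1))"
  shows "S_III k n m' u' = P 0 n"
  using power_coeff_eqI[OF S_III_fps_equation assms, of 0 n] by (simp add: S_III_fps_def)

section \<open>First-step decomposition of walks on the natural numbers\<close>

text \<open>The step \<open>d\<close> lowers the height by 1, a step \<open>s\<close> in
  \<open>U\<close> raises it by \<open>h s\<close>. The alphabet is abstract so that plain Dyck
  paths, labelled ones and quadrant paths share one decomposition.\<close>

locale walks =
  fixes U :: "'a set" and d :: 'a and h :: "'a \<Rightarrow> nat"
  assumes finite_U: "finite U" and d_notin_U: "d \<notin> U"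
begin

text \<open>Walks from height \<open>j\<close> to height \<open>0\<close> with \<open>n\<close> steps other than \<open>d\<close>.\<close>

fun walk :: "nat \<Rightarrow> nat \<Rightarrow> 'a list \<Rightarrow> bool" where
  "walk j n [] \<longleftrightarrow> j = 0 \<and> n = 0"
| "walk j n (s # w) \<longleftrightarrow> (if s = d then j > 0 \<and> walk (j - 1) n w
     else s \<in> U \<and> n > 0 \<and> walk (j + h s) (n - 1) w)"

lemma Collect_walk: "Collect (walk j n) = (if j = 0 \<and> n = 0 then {[]} else {})
   \<union> (if j = 0 then {} else (#) d ` Collect (walk (j - 1) n))
   \<union> (if n = 0 then {} else \<Union>s\<in>U. (#) s ` Collect (walk (j + h s) (n - 1)))"
proof (rule set_eqI)
  fix w
  show "w \<in> Collect (walk j n) \<longleftrightarrow> w \<in> (if j = 0 \<and> n = 0 then {[]} else {})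
   \<union> (if j = 0 then {} else (#) d ` Collect (walk (j - 1) n))
   \<union> (if n = 0 then {} else \<Union>s\<in>U. (#) s ` Collect (walk (j + h s) (n - 1)))"
    using d_notin_U by (cases w) auto
qed

lemma finite_walk: "finite (Collect (walk j n))"
proof (induction n arbitrary: j rule: less_induct)
  case (less n)
  have ups: "finite (if n = 0 then {} else \<Union>s\<in>U. (#) s ` Collect (walk (i + h s) (n - 1)))" for i
    using less finite_U by auto
  show ?case
    \<comment> \<open>Removing a step of \<open>U\<close> lowers n (outer induction); removing
      \<open>d\<close> keeps n but lowers j.\<close>
    by (induction j) (subst Collect_walk; use ups in simp)+
qed

text \<open>Words are split by their first step, and the cases are disjoint because \<open>d\<close>
  is not in \<open>U\<close>. The weight \<open>f\<close> is arbitrary, which covers both plain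
  counting and peak weights.\<close>

lemma sum_walk:
  "(\<Sum>w | walk j n w. f w) =
     (if j = 0 then (if n = 0 then f [] else 0) else \<Sum>w | walk (j - 1) n w. f (d # w))
     + (if n = 0 then 0 else \<Sum>s\<in>U. \<Sum>w | walk (j + h s) (n - 1) w. f (s # w))"
proof -
  let ?A = "if j = 0 \<and> n = 0 then {[]} else {} :: 'a list set"
  let ?B = "if j = 0 then {} else (#) d ` Collect (walk (j - 1) n)"
  let ?C = "if n = 0 then {} else \<Union>s\<in>U. (#) s ` Collect (walk (j + h s) (n - 1))"
  have fin: "finite ?B" "finite ?C"
    using finite_walk finite_U by auto
  have "(\<Sum>w | walk j n w. f w) = sum f (?A \<union> ?B \<union> ?C)"
    by (subst Collect_walk) simp
  also have "\<dots> = sum f (?A \<union> ?B) + sum f ?C"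
    using fin d_notin_U by (intro sum.union_disjoint) auto
  also have "sum f (?A \<union> ?B) = sum f ?A + sum f ?B"
    using fin by (intro sum.union_disjoint) auto
  also have "sum f ?B = (if j = 0 then 0 else \<Sum>w | walk (j - 1) n w. f (d # w))"
    by (simp add: sum.reindex)
  also have "sum f ?C = (if n = 0 then 0 else \<Sum>s\<in>U. \<Sum>w | walk (j + h s) (n - 1) w. f (s # w))"
  proof (cases "n = 0")
    case False
    have "sum f (\<Union>s\<in>U. (#) s ` Collect (walk (j + h s) (n - 1))) =
        (\<Sum>s\<in>U. sum f ((#) s ` Collect (walk (j + h s) (n - 1))))"
      using finite_walk finite_U by (intro sum.UNION_disjoint) auto
    with False show ?thesis by (simp add: sum.reindex)
  qed simp
  finally show ?thesis by simp
qed

definition height :: "'a \<Rightarrow> int" where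
  "height s = (if s = d then -1 else int (h s))"

text \<open>Turns the recursion into conditions on the endpoint and the prefixes, the form in which
  the path families are defined.\<close>

lemma walk_iff:
  "walk j n w \<longleftrightarrow> set w \<subseteq> insert d U \<and> length (filter (\<lambda>s. s \<noteq> d) w) = n \<and>
     int j + (\<Sum>s\<leftarrow>w. height s) = 0 \<and> (\<forall>i\<le>length w. 0 \<le> int j + (\<Sum>s\<leftarrow>take i w. height s))"
proof (induction w arbitrary: j n)
  case (Cons s w)
  have split: "(\<forall>i\<le>Suc l. Q i) \<longleftrightarrow> Q 0 \<and> (\<forall>i\<le>l. Q (Suc i))" for l and Q :: "nat \<Rightarrow> bool"
    by (metis Suc_le_mono le0 not0_implies_Suc)
  \<comment> \<open>Taken from the empty prefix; with x = -1 it excludes a step \<open>d\<close> at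
    height 0.\<close>
  have first: "0 \<le> x" if "\<forall>i\<le>length w. 0 \<le> x + (\<Sum>s\<leftarrow>take i w. height s)" for x
    using that[rule_format, of 0] by simp
  show ?case
  proof (cases "s = d")
    case True
    show ?thesis
    proof (cases j)
      case 0
      thus ?thesis using True first[of "-1"] by (auto simp: split height_def)
    next
      case (Suc j')
      thus ?thesis using True by (auto simp: split height_def Cons.IH algebra_simps)
    qed
  next
    case False
    show ?thesis
    proof (cases n)
      case (Suc n')
      thus ?thesis using False by (auto simp: split height_def Cons.IH algebra_simps)
    qed (use False in auto)
  qed
qed auto

end

section \<open>The path families as walks\<close>

lemma ball_vertices: "(\<forall>v\<in>vertices w. Q v) \<longleftrightarrow> (\<forall>i\<le>length w. Q (sum_list (take i w)))"
  unfolding vertices_def by blast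

lemma up_neq_down [simp]: "up \<noteq> down" "down \<noteq> up"
  by (auto simp: up_def down_def)

global_interpretation dyck: walks "{up}" down "\<lambda>_. k" for k :: nat
  defines dyck_walk = dyck.walk and dyck_height = dyck.height
  by unfold_locales auto

text \<open>The height is k y - x: it rises by k along \<open>up\<close>, falls by 1 along
  \<open>down\<close>, and is nonnegative exactly on or above the line y = x/k.\<close>

lemma Dyck_eq:
  assumes "k \<ge> 1"
  shows "Dyck n k = Collect (dyck_walk k 0 n)"
proof -
  have ups: "int (length (filter (\<lambda>s. s \<noteq> down) w)) = snd (sum_list w)"
    and ht: "(\<Sum>s\<leftarrow>w. dyck_height k s) = int k * snd (sum_list w) - fst (sum_list w)"
    if "set w \<subseteq> {up, down}" for w
    using that by (induction w) (auto simp: dyck.height_def up_def down_def algebra_simps)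
  have ineq: "real_of_int y \<ge> real_of_int x / real k \<longleftrightarrow> 0 \<le> int k * y - x" for x y
  proof -
    have "real_of_int y \<ge> real_of_int x / real k \<longleftrightarrow> real_of_int x \<le> real_of_int (int k * y)"
      using assms by (simp add: field_simps)
    thus ?thesis by (simp only: of_int_le_iff) auto
  qed
  have "w \<in> Dyck n k \<longleftrightarrow> dyck_walk k 0 n w" for w
  proof (cases "set w \<subseteq> {up, down}")
    case True
    have "set (take i w) \<subseteq> {up, down}" for i
      using True set_take_subset[of i w] by blast
    note ht' = ht[OF this]
    show ?thesis
      using True ups[OF True] ht[OF True]
      by (cases "sum_list w")
         (auto simp: Dyck_def dyck.walk_iff ball_vertices case_prod_unfold ineq ht' insert_commute)
  qed (auto simp: Dyck_def dyck.walk_iff)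
  thus ?thesis by auto
qed

global_interpretation dyck2: walks "{(up, False), (up, True)}" "(down, False)" "\<lambda>_. k" for k :: nat
  defines dyck2_walk = dyck2.walk and dyck2_height = dyck2.height
  by unfold_locales auto

lemma dyck2_walk_iff:
  "dyck2_walk k j n w \<longleftrightarrow> dyck_walk k j n (map fst w) \<and> (\<forall>(a, c)\<in>set w. a = down \<longrightarrow> \<not> c)"
  by (induction w arbitrary: j n) auto

lemma Dyck_two_up_eq: "k \<ge> 1 \<Longrightarrow> Dyck_two_up n k = Collect (dyck2_walk k 0 n)"
  by (auto simp: Dyck_two_up_def Dyck_eq dyck2_walk_iff)

global_interpretation quadrant:
  walks "{(1 :: int, int k), (2, int k - 1)}" "(1, -1)" "\<lambda>(x, y). nat y" for k :: nat
  defines quadrant_walk = quadrant.walk and quadrant_height = quadrant.height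
  by unfold_locales auto

text \<open>The sum x + y grows by k + 1 along (1, k) and (2, k - 1) and is unchanged by (1, -1). So
  a path ending at height 0 has abscissa (k + 1) n iff it has n steps of the first two
  kinds.\<close>

lemma quadrant_paths_eq:
  assumes "k \<ge> 1"
  shows "quadrant_paths n k = Collect (quadrant_walk k 0 n)"
proof -
  let ?S = "{(1, int k), (2, int k - 1), (1, -1)}"
  have ups: "int (k + 1) * int (length (filter (\<lambda>s. s \<noteq> (1, -1)) w)) = fst (sum_list w) + snd (sum_list w)"
    and ht: "(\<Sum>s\<leftarrow>w. quadrant_height s) = snd (sum_list w)"
    and nonneg: "fst (sum_list w) \<ge> 0"
    if "set w \<subseteq> ?S" for w
    using that assms by (induction w) (auto simp: quadrant.height_def algebra_simps)
  have "w \<in> quadrant_paths n k \<longleftrightarrow> quadrant_walk k 0 n w" for w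
  proof (cases "set w \<subseteq> ?S")
    case True
    have "set (take i w) \<subseteq> ?S" for i
      using True set_take_subset[of i w] by blast
    note prefix = ht[OF this] nonneg[OF this]
    let ?u = "length (filter (\<lambda>s. s \<noteq> (1, -1)) w)"
    have "sum_list w = (int ((k + 1) * n), 0) \<longleftrightarrow> ?u = n \<and> snd (sum_list w) = 0"
    proof -
      have "int (k + 1) * int ?u = int ((k + 1) * n) \<longleftrightarrow> ?u = n"
        by (simp only: of_nat_mult mult_cancel_left of_nat_eq_iff) simp
      thus ?thesis using ups[OF True] by (cases "sum_list w") auto
    qed
    thus ?thesis
      using True ht[OF True]
      by (auto simp: quadrant_paths_def quadrant.walk_iff ball_vertices case_prod_unfold prefix)
  next
    case False
    thus ?thesis by (auto simp: quadrant_paths_def quadrant.walk_iff)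
  qed
  thus ?thesis by auto
qed

section \<open>Peaks and the weighted count\<close>

lemma Peak_Nil [simp]: "Peak [] = 0"
  by (simp add: Peak_def)

lemma Peak_Cons:
  "Peak (s # w) = of_bool (s = up \<and> w \<noteq> [] \<and> hd w = down) + Peak w"
proof -
  let ?I = "\<lambda>w. {i. Suc i < length w \<and> w ! i = up \<and> w ! Suc i = down}"
  have fin: "finite (?I w)" by (rule finite_subset[of _ "{..<length w}"]) auto
  have "i \<in> ?I (s # w) \<longleftrightarrow>
      i \<in> (if s = up \<and> w \<noteq> [] \<and> hd w = down then {0} else {}) \<union> Suc ` ?I w" for i
    by (cases i; cases w) auto
  hence eq: "?I (s # w) = (if s = up \<and> w \<noteq> [] \<and> hd w = down then {0} else {}) \<union> Suc ` ?I w"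
    by blast
  have "card (Suc ` ?I w) = card (?I w)" by (rule card_image) simp
  thus ?thesis unfolding Peak_def eq using fin by (subst card_Un_disjoint) auto
qed

text \<open>Each peak uses its own up step. The bound keeps the exponent \<open>n - Peak w\<close>
  from truncating.\<close>

lemma Peak_le: "dyck_walk k j n w \<Longrightarrow> Peak w \<le> n"
proof (induction w arbitrary: j n)
  case (Cons s w)
  thus ?case by (force simp: Peak_Cons split: if_splits)
qed simp

text \<open>
  An up step has weight 3, or 4 if a down step follows. The extra 1 is collected by the walks
  that start with a down step, and these correspond to the walks from one level below.
\<close>

lemma sum_Peak_up:
  assumes "j \<ge> 1"
  shows "(\<Sum>w | dyck_walk k j n w. 4 ^ Peak (up # w) * 3 ^ (Suc n - Peak (up # w))) =
    (\<Sum>w | dyck_walk k (j - 1) n w. 4 ^ Peak w * 3 ^ (n - Peak w)) +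
    3 * (\<Sum>w | dyck_walk k j n w. 4 ^ Peak w * 3 ^ (n - Peak w) :: int)"
proof -
  let ?f = "\<lambda>w. 4 ^ Peak w * 3 ^ (n - Peak w) :: int"
  have "(\<Sum>w | dyck_walk k j n w. 4 ^ Peak (up # w) * 3 ^ (Suc n - Peak (up # w))) =
     (\<Sum>w | dyck_walk k j n w. (if w \<noteq> [] \<and> hd w = down then ?f w else 0) + 3 * ?f w)"
  proof (rule sum.cong)
    fix w assume "w \<in> {w. dyck_walk k j n w}"
    hence "Peak w \<le> n" by (auto dest: Peak_le)
    thus "4 ^ Peak (up # w) * 3 ^ (Suc n - Peak (up # w)) =
        (if w \<noteq> [] \<and> hd w = down then ?f w else 0) + 3 * ?f w"
      by (auto simp: Peak_Cons Suc_diff_le)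
  qed simp
  also have "\<dots> = (\<Sum>w | dyck_walk k j n w. if w \<noteq> [] \<and> hd w = down then ?f w else 0) +
      3 * (\<Sum>w | dyck_walk k j n w. ?f w)"
    by (simp add: sum.distrib sum_distrib_left)
  \<comment> \<open>Only walks starting with \<open>down\<close> contribute, and deleting that step
    loses no peak.\<close>
  also have "(\<Sum>w | dyck_walk k j n w. if w \<noteq> [] \<and> hd w = down then ?f w else 0) =
      (\<Sum>w | dyck_walk k (j - 1) n w. ?f w)"
    by (subst dyck.sum_walk) (use assms in \<open>simp add: Peak_Cons\<close>)
  finally show ?thesis .
qed

theorem proposition4p31:
  fixes k n :: nat
  assumes "k \<ge> 2"
  shows "S_III k n 0 0 = int (card (Dyck n k))
       \<and> S_III k n 0 1 = int (card (Dyck_two_up n k))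
       \<and> S_III k n 0 1 = 2 ^ n * int (card (Dyck n k))
       \<and> S_III k n 1 0 = int (card (quadrant_paths n k))
       \<and> S_III k n 1 1 = (\<Sum>w \<in> Dyck n k. 4 ^ Peak w * 3 ^ (n - Peak w))"
proof (intro conjI)
  from assms have k: "k \<ge> 1" by simp
  have card: "int (card A) = (\<Sum>w\<in>A. 1)" for A :: "'b set" by simp
  let ?D = "\<lambda>j n. \<Sum>w | dyck_walk k j n w. 1 :: int"
  have D: "?D j n = (if j = 0 then of_bool (n = 0) else ?D (j - 1) n)
      + (if n = 0 then 0 else ?D (j + k) (n - 1))" for j n
    by (subst dyck.sum_walk) simp
  \<comment> \<open>Here a = 0 and c = 1.\<close>
  show "S_III k n 0 0 = int (card (Dyck n k))"
    unfolding Dyck_eq[OF k] card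
    by (rule S_III_eqI[OF k], subst D) simp
  \<comment> \<open>Here a = 0 and c = 2, one unit for each label of an up step.\<close>
  show "S_III k n 0 1 = int (card (Dyck_two_up n k))"
    unfolding Dyck_two_up_eq[OF k] card
    by (rule S_III_eqI[OF k], subst dyck2.sum_walk) simp
  \<comment> \<open>The same recursion, with c = 2 now coming from 2^n = 2 * 2^(n - 1).\<close>
  show "S_III k n 0 1 = 2 ^ n * int (card (Dyck n k))"
    unfolding Dyck_eq[OF k] card
  proof (rule S_III_eqI[OF k, where P = "\<lambda>j n. 2 ^ n * ?D j n"])
    show "2 ^ n * ?D j n = (if j = 0 then of_bool (n = 0) else 2 ^ n * ?D (j - 1) n)
      + (if n = 0 then 0 else 0 * (2 ^ (n - 1) * ?D (j + k - 1) (n - 1))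
          + ((0 + 1) * 1 + 1) * (2 ^ (n - 1) * ?D (j + k) (n - 1)))" for j n
      by (subst D, cases n) (auto simp: distrib_left)
  qed
  \<comment> \<open>For a = c = 1: the steps (2, k - 1) and (1, k) lead from height j to j + k - 1
    and j + k.\<close>
  have nat_k: "nat (int k - 1) = k - 1" "j + (k - 1) = j + k - 1" for j
    using k by auto
  show "S_III k n 1 0 = int (card (quadrant_paths n k))"
    unfolding quadrant_paths_eq[OF k] card
    by (rule S_III_eqI[OF k], subst quadrant.sum_walk) (use k in \<open>simp add: nat_k\<close>)
  let ?W = "\<lambda>j n. \<Sum>w | dyck_walk k j n w. 4 ^ Peak w * 3 ^ (n - Peak w) :: int"
  show "S_III k n 1 1 = (\<Sum>w \<in> Dyck n k. 4 ^ Peak w * 3 ^ (n - Peak w))"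
    unfolding Dyck_eq[OF k]
  proof (rule S_III_eqI[OF k, where P = ?W])
    fix j n
    \<comment> \<open>This produces a = 1 and c = 3: an initial up step reaches height j + k, and
      the bonus for a following down step accounts for the walks from j + k - 1.\<close>
    have up: "(\<Sum>w | dyck_walk k (j + k) (n - 1) w. 4 ^ Peak (up # w) * 3 ^ (n - Peak (up # w))) =
        ?W (j + k - 1) (n - 1) + 3 * ?W (j + k) (n - 1)" if "n \<noteq> 0"
      using sum_Peak_up[where j = "j + k" and k = k and n = "n - 1"] k that by simp
    show "?W j n = (if j = 0 then of_bool (n = 0) else ?W (j - 1) n)
      + (if n = 0 then 0 else 1 * ?W (j + k - 1) (n - 1) + ((1 + 1) * 1 + 1) * ?W (j + k) (n - 1))"
      by (subst dyck.sum_walk) (use up in \<open>simp add: Peak_Cons[of down]\<close>)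
  qed
qed

end
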